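(* Let $\mu$ be a positive finite Borel measure on $[0,1)$ and let $R_\mu$ be the Rhaly operator associated to the moment sequence $(\mu_n)_{n\ge 0}$, $\mu_n=\int_0^1 t^n\,d\mu(t)$. Assume that $R_\mu$ is a bounded operator on $\ell^2$. Then the numerical range satisfies $W(R_\mu)\subset\{z\in\mathbb{C}:\ \operatorname{Re} z\ge 0\}$ and, consequently, the spectrum satisfies $\sigma(R_\mu)\subset\{z\in\mathbb{C}:\ \operatorname{Re} z\ge 0\}$.
   Context: $\ell^2=\ell^2(\mathbb{N}_0)$ is the complex Hilbert space of square-summable sequences $(x_n)_{n\ge 0}$. The Rhaly operator $R_\mu$ is given by the lower triangular matrix whose $(n,k)$ entry is $\mu_n$ for $0\le k\le n$ and $0$ for $k>n$, i.e. $(R_\mu x)_n=\mu_n\sum_{k=0}^n x_k$. For a bounded operator $T$ on a Hilbert space $H$, the numerical range is $W(T)=\{\langle Tx,x\rangle:\ x\in H,\ \|x\|=1\}$. The convention $0^0=1$ is used in $\mu_0=\mu([0,1))$. *)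

theory Defs
  imports "HOL-Analysis.Analysis"
begin

text \<open>The complex Hilbert space of square-summable sequences is represented by a carrier set of
  functions; operators are functions on sequences of which only the values on this set matter.
  The inner product is linear in its first argument.\<close>

definition l2 :: "(nat \<Rightarrow> complex) set" where
  "l2 = {x. summable (\<lambda>n. (cmod (x n))\<^sup>2)}"

definition l2_inner :: "(nat \<Rightarrow> complex) \<Rightarrow> (nat \<Rightarrow> complex) \<Rightarrow> complex" where
  "l2_inner x y = (\<Sum>n. x n * cnj (y n))"

definition l2_norm :: "(nat \<Rightarrow> complex) \<Rightarrow> real" where
  "l2_norm x = sqrt (\<Sum>n. (cmod (x n))\<^sup>2)"

definition bounded_operator_l2 :: "((nat \<Rightarrow> complex) \<Rightarrow> nat \<Rightarrow> complex) \<Rightarrow> bool" where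
  "bounded_operator_l2 T \<longleftrightarrow>
     (\<forall>x\<in>l2. T x \<in> l2) \<and>
     (\<forall>x\<in>l2. \<forall>y\<in>l2. T (\<lambda>n. x n + y n) = (\<lambda>n. T x n + T y n)) \<and>
     (\<forall>c. \<forall>x\<in>l2. T (\<lambda>n. c * x n) = (\<lambda>n. c * T x n)) \<and>
     (\<exists>C. \<forall>x\<in>l2. l2_norm (T x) \<le> C * l2_norm x)"

definition numerical_range :: "((nat \<Rightarrow> complex) \<Rightarrow> nat \<Rightarrow> complex) \<Rightarrow> complex set" where
  "numerical_range T = {l2_inner (T x) x | x. x \<in> l2 \<and> l2_norm x = 1}"

text \<open>The complement of the set of all \<open>z\<close> for which \<open>T - z I\<close> has a bounded
  two-sided inverse on \<open>l2\<close>.\<close>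

definition spectrum_l2 :: "((nat \<Rightarrow> complex) \<Rightarrow> nat \<Rightarrow> complex) \<Rightarrow> complex set" where
  "spectrum_l2 T = {z. \<not> (\<exists>S. bounded_operator_l2 S \<and>
     (\<forall>x\<in>l2. S (\<lambda>n. T x n - z * x n) = x) \<and>
     (\<forall>x\<in>l2. (\<lambda>n. T (S x) n - z * S x n) = x))}"

definition moment :: "real measure \<Rightarrow> nat \<Rightarrow> real" where
  "moment M n = (\<integral>t. t ^ n \<partial>M)"

definition rhaly :: "(nat \<Rightarrow> real) \<Rightarrow> (nat \<Rightarrow> complex) \<Rightarrow> nat \<Rightarrow> complex" where
  "rhaly a x n = complex_of_real (a n) * (\<Sum>k\<le>n. x k)"

end

theory Submission imports Defs begin

text \<open>With the partial sums \<open>s\<^sub>n = x\<^sub>0 + \<dots> + x\<^sub>n\<close> one has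
  \<open>2 Re (s\<^sub>n \<cdot> cnj x\<^sub>n) \<ge> \<bar>s\<^sub>n\<bar>\<^sup>2 - \<bar>s\<^sub>n\<^sub>-\<^sub>1\<bar>\<^sup>2\<close>. Since the moments are
  nonnegative and decreasing, summation by parts makes every partial sum of
  \<open>Re \<langle>R x, x\<rangle>\<close> nonnegative, for an arbitrary sequence \<open>x\<close>. For \<open>Re z < 0\<close> the triangular
  system \<open>(R - z) x = y\<close> is uniquely solvable in the space of all sequences, and the same
  inequality for partial sums bounds the norm of \<open>x\<close> by that of \<open>y\<close>; so the solution
  operator maps \<open>l2\<close> boundedly into itself.\<close>

lemma moment_nonneg_antimono:
  assumes "finite_measure M" and sets: "sets M = sets (restrict_space borel {0..<1::real})"
  shows "moment M n \<ge> 0" and "moment M (Suc n) \<le> moment M n"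
proof -
  interpret finite_measure M by fact
  have space: "space M = {0..<1}"
    using sets_eq_imp_space_eq[OF sets] by (simp add: space_restrict_space)
  \<comment> \<open>Monotonicity of the integral needs this, as a non-integrable function has
    integral 0 by default. On \<open>[0,1)\<close> the powers are bounded by 1 and \<open>M\<close>
    is finite.\<close>
  have integrable: "integrable M (\<lambda>t. t ^ k)" for k
  proof (rule integrable_const_bound)
    show "(\<lambda>t. t ^ k) \<in> borel_measurable M"
      unfolding measurable_cong_sets[OF sets refl] by (rule measurable_restrict_space1) measurable
    show "AE t in M. norm (t ^ k) \<le> 1"
      by (rule AE_I2) (auto simp: space power_le_one)
  qed
  show "moment M n \<ge> 0"
    unfolding moment_def by (rule integral_nonneg_AE, rule AE_I2) (auto simp: space)
  show "moment M (Suc n) \<le> moment M n"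
    unfolding moment_def
    by (rule integral_mono[OF integrable integrable]) (auto simp: space mult_left_le_one_le)
qed

text \<open>The right-hand side is the boundary term of the summation by parts. It is kept because
  bare nonnegativity is not inductive: the next step has to absorb a negative multiple of
  \<open>(cmod s)\<^sup>2\<close>.\<close>

lemma Re_sum_rhaly_ge:
  assumes nonneg: "\<And>n. a n \<ge> 0" and decr: "\<And>n. a (Suc n) \<le> a n"
  shows "(\<Sum>n\<le>N. Re (rhaly a x n * cnj (x n))) \<ge> a N * (cmod (\<Sum>k\<le>N. x k))\<^sup>2 / 2"
proof (induction N)
  case 0
  show ?case
    using nonneg[of 0] unfolding cmod_power2
    by (simp add: rhaly_def power2_eq_square algebra_simps)
next
  case (Suc N)
  define s t where "s = (\<Sum>k\<le>N. x k)" and "t = x (Suc N)"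
  \<comment> \<open>The two sides differ by exactly \<open>(cmod t)\<^sup>2\<close>.\<close>
  have square: "(cmod (s + t))\<^sup>2 - (cmod s)\<^sup>2 \<le> 2 * Re ((s + t) * cnj t)"
    unfolding cmod_power2 by (simp add: power2_eq_square algebra_simps)
  have "a (Suc N) * (cmod (s + t))\<^sup>2 / 2 \<le> a (Suc N) * (cmod s)\<^sup>2 / 2 + a (Suc N) * Re ((s + t) * cnj t)"
    using mult_left_mono[OF square nonneg[of "Suc N"]] by (simp add: algebra_simps)
  also have "\<dots> \<le> a N * (cmod s)\<^sup>2 / 2 + a (Suc N) * Re ((s + t) * cnj t)"
    using mult_right_mono[OF decr[of N], of "(cmod s)\<^sup>2"] by simp
  also have "a (Suc N) * Re ((s + t) * cnj t) = Re (rhaly a x (Suc N) * cnj (x (Suc N)))"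
    by (simp add: rhaly_def s_def t_def mult.assoc)
  finally show ?case
    using Suc.IH by (simp add: s_def t_def)
qed

lemma Re_sum_rhaly_nonneg:
  assumes "\<And>n. a n \<ge> 0" and "\<And>n. a (Suc n) \<le> a n"
  shows "(\<Sum>n\<le>N. Re (rhaly a x n * cnj (x n))) \<ge> 0"
  by (rule order_trans[OF _ Re_sum_rhaly_ge]) (use assms in auto)

lemma summable_l2_inner:
  assumes "x \<in> l2" "y \<in> l2"
  shows "summable (\<lambda>n. x n * cnj (y n))"
proof (rule summable_norm_cancel, rule summable_comparison_test')
  show "summable (\<lambda>n. (cmod (x n))\<^sup>2 + (cmod (y n))\<^sup>2)"
    using assms by (auto simp: l2_def intro: summable_add)
  show "norm (norm (x n * cnj (y n))) \<le> (cmod (x n))\<^sup>2 + (cmod (y n))\<^sup>2" for n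
    using sum_squares_bound[of "cmod (x n)" "cmod (y n)"]
      mult_nonneg_nonneg[OF norm_ge_zero[of "x n"] norm_ge_zero[of "y n"]]
    unfolding norm_mult complex_mod_cnj real_norm_def abs_mult abs_norm_cancel by linarith
qed

text \<open>A limit of nonnegative partial sums; the series converges because both factors are in
  \<open>l2\<close>.\<close>

lemma Re_l2_inner_rhaly_nonneg:
  assumes "\<And>n. a n \<ge> 0" "\<And>n. a (Suc n) \<le> a n" and "x \<in> l2" "rhaly a x \<in> l2"
  shows "Re (l2_inner (rhaly a x) x) \<ge> 0"
proof -
  have "(\<lambda>n. \<Sum>k\<le>n. Re (rhaly a x k * cnj (x k))) \<longlonglongrightarrow> Re (l2_inner (rhaly a x) x)"
    using sums_Re[OF summable_sums[OF summable_l2_inner[OF assms(4,3)]]]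
    unfolding sums_def_le l2_inner_def .
  then show ?thesis
    by (rule LIMSEQ_le_const) (use Re_sum_rhaly_nonneg[of a, OF assms(1,2)] in auto)
qed

text \<open>Forward substitution: row \<open>n\<close> of \<open>(R - z) x = y\<close> is solved for
  \<open>x n\<close>, whose coefficient is the diagonal entry \<open>a n - z\<close>.\<close>

fun rhaly_resolvent :: "(nat \<Rightarrow> real) \<Rightarrow> complex \<Rightarrow> (nat \<Rightarrow> complex) \<Rightarrow> nat \<Rightarrow> complex" where
  "rhaly_resolvent a z y n =
     (y n - complex_of_real (a n) * (\<Sum>k<n. rhaly_resolvent a z y k)) / (complex_of_real (a n) - z)"

declare rhaly_resolvent.simps [simp del]

text \<open>Stated for arbitrary sequences, so that it yields both inverse identities and, by
  uniqueness, the linearity of the resolvent.\<close>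

lemma rhaly_resolvent_iff:
  assumes "\<And>n. complex_of_real (a n) \<noteq> z"
  shows "(\<lambda>n. rhaly a x n - z * x n) = y \<longleftrightarrow> x = rhaly_resolvent a z y"
proof -
  have step: "rhaly a x n - z * x n = y n \<longleftrightarrow>
      x n = (y n - complex_of_real (a n) * (\<Sum>k<n. x k)) / (complex_of_real (a n) - z)" for x n
    using assms[of n]
    by (simp add: rhaly_def lessThan_Suc_atMost[symmetric] nonzero_eq_divide_eq) (auto simp: algebra_simps)
  show ?thesis
  proof
    assume eq: "(\<lambda>n. rhaly a x n - z * x n) = y"
    have "x n = rhaly_resolvent a z y n" for n
    proof (induction n rule: less_induct)
      case (less n)
      then have "(\<Sum>k<n. x k) = (\<Sum>k<n. rhaly_resolvent a z y k)"
        by (intro sum.cong) auto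
      with fun_cong[OF eq, of n] show ?case
        by (subst rhaly_resolvent.simps) (simp only: step)
    qed
    then show "x = rhaly_resolvent a z y" ..
  next
    assume "x = rhaly_resolvent a z y"
    then show "(\<lambda>n. rhaly a x n - z * x n) = y"
      using step rhaly_resolvent.simps by blast
  qed
qed

text \<open>Pair \<open>y = (R - z) x\<close> with \<open>x\<close> and take real parts. The sums
  are truncated because \<open>x\<close> is not yet known to lie in \<open>l2\<close>.\<close>

lemma sum_cmod_power2_le:
  assumes "\<And>n. a n \<ge> 0" "\<And>n. a (Suc n) \<le> a n" and z: "Re z < 0"
    and y: "\<And>n. rhaly a x n - z * x n = y n"
  shows "(Re z)\<^sup>2 * (\<Sum>n\<le>N. (cmod (x n))\<^sup>2) \<le> (\<Sum>n\<le>N. (cmod (y n))\<^sup>2)"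
proof -
  \<comment> \<open>AM-GM with weight \<open>- Re z\<close>, chosen so that the \<open>x\<close>
    term is half of \<open>2 * (Re z)\<^sup>2 * (cmod (x n))\<^sup>2\<close> and can be absorbed at
    the end.\<close>
  have pointwise: "2 * (- Re z) * Re (y n * cnj (x n)) \<le> (cmod (y n))\<^sup>2 + (Re z)\<^sup>2 * (cmod (x n))\<^sup>2" for n
  proof -
    have "2 * ((- Re z) * Re (y n * cnj (x n))) \<le> 2 * ((- Re z) * (cmod (y n) * cmod (x n)))"
      using z complex_Re_le_cmod[of "y n * cnj (x n)"]
      by (intro mult_left_mono) (auto simp: norm_mult)
    also have "\<dots> \<le> (cmod (y n))\<^sup>2 + (Re z)\<^sup>2 * (cmod (x n))\<^sup>2"
      using sum_squares_bound[of "cmod (y n)" "- Re z * cmod (x n)"]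
      by (simp add: power_mult_distrib algebra_simps)
    finally show ?thesis by simp
  qed
  have "Re (y n * cnj (x n)) = Re (rhaly a x n * cnj (x n)) - Re z * (cmod (x n))\<^sup>2" for n
    unfolding y[symmetric] cmod_power2 by (simp add: power2_eq_square algebra_simps)
  then have "(\<Sum>n\<le>N. Re (y n * cnj (x n)))
      = (\<Sum>n\<le>N. Re (rhaly a x n * cnj (x n))) - Re z * (\<Sum>n\<le>N. (cmod (x n))\<^sup>2)"
    by (simp only: sum_subtractf sum_distrib_left)
  then have lower: "- Re z * (\<Sum>n\<le>N. (cmod (x n))\<^sup>2) \<le> (\<Sum>n\<le>N. Re (y n * cnj (x n)))"
    using Re_sum_rhaly_nonneg[of a, OF assms(1,2)] by simp
  have "2 * (Re z)\<^sup>2 * (\<Sum>n\<le>N. (cmod (x n))\<^sup>2) = 2 * (- Re z) * (- Re z * (\<Sum>n\<le>N. (cmod (x n))\<^sup>2))"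
    by (simp add: power2_eq_square)
  also have "\<dots> \<le> 2 * (- Re z) * (\<Sum>n\<le>N. Re (y n * cnj (x n)))"
    using z by (intro mult_left_mono[OF lower]) simp
  also have "\<dots> = (\<Sum>n\<le>N. 2 * (- Re z) * Re (y n * cnj (x n)))"
    by (rule sum_distrib_left)
  also have "\<dots> \<le> (\<Sum>n\<le>N. (cmod (y n))\<^sup>2 + (Re z)\<^sup>2 * (cmod (x n))\<^sup>2)"
    by (rule sum_mono[OF pointwise])
  also have "\<dots> = (\<Sum>n\<le>N. (cmod (y n))\<^sup>2) + (Re z)\<^sup>2 * (\<Sum>n\<le>N. (cmod (x n))\<^sup>2)"
    by (simp only: sum.distrib sum_distrib_left)
  finally show ?thesis by simp
qed

text \<open>The truncated estimate is uniform in \<open>N\<close>, so it gives membership in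
  \<open>l2\<close> and the norm bound together.\<close>

lemma l2_bounded_by_solution:
  assumes "\<And>n. a n \<ge> 0" "\<And>n. a (Suc n) \<le> a n" and z: "Re z < 0"
    and eq: "\<And>n. rhaly a x n - z * x n = y n" and y: "y \<in> l2"
  shows "x \<in> l2" and "l2_norm x \<le> 1 / \<bar>Re z\<bar> * l2_norm y"
proof -
  define B where "B = (\<Sum>n. (cmod (y n))\<^sup>2) / (Re z)\<^sup>2"
  have partial: "(\<Sum>n\<le>N. (cmod (x n))\<^sup>2) \<le> B" for N
  proof -
    have "(\<Sum>n\<le>N. (cmod (y n))\<^sup>2) \<le> (\<Sum>n. (cmod (y n))\<^sup>2)"
      by (rule sum_le_suminf) (use y in \<open>auto simp: l2_def\<close>)
    with sum_cmod_power2_le[of a, OF assms(1-4), of N] z show ?thesis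
      by (simp add: B_def field_simps)
  qed
  have bound: "(\<Sum>n<N. (cmod (x n))\<^sup>2) \<le> B" for N
    by (rule order_trans[OF sum_mono2 partial[of N]]) auto
  have summable: "summable (\<lambda>n. (cmod (x n))\<^sup>2)"
    by (rule bounded_imp_summable[OF _ partial]) simp
  then show "x \<in> l2" by (simp add: l2_def)
  have "(\<Sum>n. (cmod (x n))\<^sup>2) \<le> B"
    by (rule suminf_le_const[OF summable bound])
  from real_sqrt_le_mono[OF this] show "l2_norm x \<le> 1 / \<bar>Re z\<bar> * l2_norm y"
    unfolding l2_norm_def B_def by (simp add: real_sqrt_divide)
qed

lemma bounded_rhaly_resolvent:
  assumes "\<And>n. a n \<ge> 0" "\<And>n. a (Suc n) \<le> a n" and z: "Re z < 0"
  shows "bounded_operator_l2 (rhaly_resolvent a z)"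
proof -
  have "complex_of_real (a n) \<noteq> z" for n
    using assms(1)[of n] z by auto
  note iff = rhaly_resolvent_iff[of a z, OF this]
  have solves: "rhaly a (rhaly_resolvent a z y) n - z * rhaly_resolvent a z y n = y n" for y n
    by (rule fun_cong[OF iff[THEN iffD2, OF refl]])
  note bounds = l2_bounded_by_solution[of a, OF assms solves]
  \<comment> \<open>Linearity by uniqueness: the sum of two solutions solves the system with the
    summed right-hand side; scalar multiples are treated alike.\<close>
  have "rhaly_resolvent a z (\<lambda>n. x n + y n) = (\<lambda>n. rhaly_resolvent a z x n + rhaly_resolvent a z y n)" for x y
  proof (rule iff[THEN iffD1, symmetric], rule ext)
    fix n
    show "rhaly a (\<lambda>n. rhaly_resolvent a z x n + rhaly_resolvent a z y n) n
        - z * (rhaly_resolvent a z x n + rhaly_resolvent a z y n) = x n + y n"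
      using solves[of x n] solves[of y n] by (simp add: rhaly_def sum.distrib algebra_simps)
  qed
  moreover have "rhaly_resolvent a z (\<lambda>n. c * x n) = (\<lambda>n. c * rhaly_resolvent a z x n)" for c x
  proof (rule iff[THEN iffD1, symmetric], rule ext)
    fix n
    show "rhaly a (\<lambda>n. c * rhaly_resolvent a z x n) n - z * (c * rhaly_resolvent a z x n) = c * x n"
      by (subst solves[of x n, symmetric])
        (simp add: rhaly_def right_diff_distrib mult.left_commute flip: sum_distrib_left)
  qed
  ultimately show ?thesis
    unfolding bounded_operator_l2_def using bounds by blast
qed

theorem theorem2p7:
  fixes M :: "real measure"
  assumes "finite_measure M"
    and "sets M = sets (restrict_space borel {0..<1})"
    and "bounded_operator_l2 (rhaly (moment M))"
  shows "numerical_range (rhaly (moment M)) \<subseteq> {z. Re z \<ge> 0} \<and>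
         spectrum_l2 (rhaly (moment M)) \<subseteq> {z. Re z \<ge> 0}"
proof
  note moments = moment_nonneg_antimono[OF assms(1,2)]
  \<comment> \<open>Boundedness supplies \<open>rhaly (moment M) x \<in> l2\<close>.\<close>
  show "numerical_range (rhaly (moment M)) \<subseteq> {z. Re z \<ge> 0}"
    using Re_l2_inner_rhaly_nonneg[of "moment M", OF moments] assms(3)
    by (auto simp: numerical_range_def bounded_operator_l2_def)
  show "spectrum_l2 (rhaly (moment M)) \<subseteq> {z. Re z \<ge> 0}"
  proof (rule subsetI, rule ccontr)
    fix z assume spec: "z \<in> spectrum_l2 (rhaly (moment M))" and "z \<notin> {z. Re z \<ge> 0}"
    then have z: "Re z < 0" by simp
    then have "complex_of_real (moment M n) \<noteq> z" for n
      using moments(1)[of n] by auto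
    note iff = rhaly_resolvent_iff[of "moment M" z, OF this]
    \<comment> \<open>An explicit inverse is exhibited, instead of passing through the closure of
      the numerical range.\<close>
    have "z \<notin> spectrum_l2 (rhaly (moment M))"
      unfolding spectrum_l2_def mem_Collect_eq not_not
    proof (intro exI conjI ballI)
      show "bounded_operator_l2 (rhaly_resolvent (moment M) z)"
        by (rule bounded_rhaly_resolvent[of "moment M", OF moments z])
      show "rhaly_resolvent (moment M) z (\<lambda>n. rhaly (moment M) x n - z * x n) = x" for x
        by (rule iff[THEN iffD1, OF refl, symmetric])
      show "(\<lambda>n. rhaly (moment M) (rhaly_resolvent (moment M) z x) n
          - z * rhaly_resolvent (moment M) z x n) = x" for x
        by (rule iff[THEN iffD2, OF refl])
    qed
    with spec show False by blast
  qed
qed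

end
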